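(* Let $m$ be a non-negative integer, $\alpha,\beta>0$ and $z\in\mathbb{C}$. Then, for $|z|<1$, $$\big(P_m^{(\alpha,\beta)}(1-2z)\big)^3=\Big(\frac{(\alpha+1)_m}{m!}\Big)^3F^3(-m,m+\alpha+\beta+1;\alpha+1;z)=\Big(\frac{(\alpha+1)_m}{m!}\Big)^3\sum_{n=0}^\infty v_n z^n,$$ with $v_0=1$, $v_1=-3m(m+\alpha+\beta+1)/(\alpha+1)$, $v_2=\frac{3m^2(\alpha+\beta+m+1)^2}{(\alpha+1)^2}+\frac{3(m-1)m(\alpha+\beta+m+2)(\alpha+\beta+m+1)}{2(\alpha+1)(\alpha+2)}$ and $$v_{n+1}=\frac{N_0(n)}{D(n)}v_n+\frac{N_1(n)}{D(n)}v_{n-1}+\frac{N_2(n)}{D(n)}v_{n-2},\qquad n\ge 2,$$ where $D(n)=(n+1)(\alpha+n+1)(2\alpha+n+1)(3\alpha+n+1)$, $$\begin{aligned}N_0(n)={}&3n^4+6(3\alpha+\beta+1)n^3+\big(11\alpha(3\alpha+2\beta+2)+4(\beta+1)-10m^2-10m(\alpha+\beta+1)\big)n^2\\&+\big(18\alpha^3+18\alpha^2(\beta+1)+7\alpha(\beta+1)+\beta\big)n\\&-\big(10(3\alpha+1)m^2+10(3\alpha+1)m(\alpha+\beta+1)-1\big)n\\&-3(6\alpha^2+5\alpha+1)m(\alpha+\beta+m+1),\end{aligned}$$ $$\begin{aligned}N_1(n)={}&-3n^4-6(3\alpha+2\beta)n^3\\&+\big(-33\alpha^2+\alpha(10-44\beta)-11\beta^2+10\beta+20m^2+20m(\alpha+\beta+1)+3\big)n^2\\&+3\big(-6\alpha^3+\alpha(-6\beta^2+15\beta+20m^2+10(3\beta+2)m+3)\big)n\\&+3\big(\beta(5\beta+10m^2+10(\beta+1)m+1)+2\alpha^2(-6\beta+10m+5)\big)n\\&+(\alpha+\beta)(3\alpha(6\alpha+6\beta+1)-4\beta-1)-9m^4-18m^3(\alpha+\beta+1)\\&+m^2\big(27\alpha^2+9\alpha(2\beta-3)-9\beta(\beta+3)-11\big)\\&+m(\alpha+\beta+1)(9\alpha(4\alpha+4\beta-1)-9\beta-2),\end{aligned}$$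 $$N_2(n)=(-3m+n-2)(\alpha+\beta-m+n-2)(3\alpha+3\beta+3m+n-2)\big(2(\alpha+\beta-1)+m+n\big).$$
   Context: $P_m^{(\alpha,\beta)}$ is the Jacobi polynomial with the standard normalization $P_m^{(\alpha,\beta)}(1)=(\alpha+1)_m/m!$. $F(a,b;c;z)=\sum_{k=0}^\infty \frac{(a)_k(b)_k}{(c)_k\,k!}z^k$, $|z|<1$, $-c\notin\mathbb{N}\cup\{0\}$, is the Gaussian hypergeometric function, with $(x)_k=x(x+1)\cdots(x+k-1)$, $(x)_0=1$; $F^3$ denotes its cube.
   Formalization: The printed N_2(n) is a misprint (for m=α=β=1 it gives v_3=-279/40, not -8); the formal statement uses N_2(n)=(-3m+n-2)(α+β+1-m+n-2)(3(α+β+1)+3m+n-2)(2(α+β)+m+n), i.e. α+β replaced by α+β+1. *)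

theory Defs
  imports "HOL-Analysis.Analysis"
begin

text \<open>
  The Jacobi polynomial of degree \<open>m\<close> on \<open>[-1, 1]\<close>, for \<open>\<alpha>, \<beta> > -1\<close>: orthogonal, with respect to
  the weight \<open>(1 - x)\<^sup>\<alpha> (1 + x)\<^sup>\<beta>\<close>, to all polynomials of lower degree, and normalized by its
  value at \<open>1\<close>. These conditions determine the polynomial uniquely. It has real coefficients;
  \<open>jacobi_P\<close> evaluates it at complex points.
\<close>

definition is_jacobi_poly :: "nat \<Rightarrow> real \<Rightarrow> real \<Rightarrow> real poly \<Rightarrow> bool" where
  "is_jacobi_poly m \<alpha> \<beta> p \<longleftrightarrow>
     degree p = m \<and>
     (\<forall>q :: real poly. degree q < m \<longrightarrow>
        ((\<lambda>x. (1 - x) powr \<alpha> * (1 + x) powr \<beta> * poly p x * poly q x) has_integral 0) {-1..1}) \<and>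
     poly p 1 = pochhammer (\<alpha> + 1) m / fact m"

definition jacobi_poly :: "nat \<Rightarrow> real \<Rightarrow> real \<Rightarrow> real poly" where
  "jacobi_poly m \<alpha> \<beta> = (THE p. is_jacobi_poly m \<alpha> \<beta> p)"

definition jacobi_P :: "nat \<Rightarrow> real \<Rightarrow> real \<Rightarrow> complex \<Rightarrow> complex" where
  "jacobi_P m \<alpha> \<beta> w = poly (map_poly complex_of_real (jacobi_poly m \<alpha> \<beta>)) w"

text \<open>
  The last argument of \<open>fps_hypergeo\<close> is a scaling factor for the variable, so the \<open>k\<close>-th
  coefficient below is \<open>(a)\<^sub>k (b)\<^sub>k / ((c)\<^sub>k k!)\<close>.
\<close>

definition hyp2F1 :: "complex \<Rightarrow> complex \<Rightarrow> complex \<Rightarrow> complex \<Rightarrow> complex" where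
  "hyp2F1 a b c z = eval_fps (fps_hypergeo [a, b] [c] 1) z"

definition rec_D :: "real \<Rightarrow> real \<Rightarrow> real" where
  "rec_D \<alpha> n = (n + 1) * (\<alpha> + n + 1) * (2 * \<alpha> + n + 1) * (3 * \<alpha> + n + 1)"

definition rec_N0 :: "real \<Rightarrow> real \<Rightarrow> real \<Rightarrow> real \<Rightarrow> real" where
  "rec_N0 m \<alpha> \<beta> n =
     3 * n ^ 4 + 6 * (3 * \<alpha> + \<beta> + 1) * n ^ 3
     + (11 * \<alpha> * (3 * \<alpha> + 2 * \<beta> + 2) + 4 * (\<beta> + 1) - 10 * m ^ 2 - 10 * m * (\<alpha> + \<beta> + 1)) * n ^ 2
     + (18 * \<alpha> ^ 3 + 18 * \<alpha> ^ 2 * (\<beta> + 1) + 7 * \<alpha> * (\<beta> + 1) + \<beta>) * n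
     - (10 * (3 * \<alpha> + 1) * m ^ 2 + 10 * (3 * \<alpha> + 1) * m * (\<alpha> + \<beta> + 1) - 1) * n
     - 3 * (6 * \<alpha> ^ 2 + 5 * \<alpha> + 1) * m * (\<alpha> + \<beta> + m + 1)"

definition rec_N1 :: "real \<Rightarrow> real \<Rightarrow> real \<Rightarrow> real \<Rightarrow> real" where
  "rec_N1 m \<alpha> \<beta> n =
     - 3 * n ^ 4 - 6 * (3 * \<alpha> + 2 * \<beta>) * n ^ 3
     + (- 33 * \<alpha> ^ 2 + \<alpha> * (10 - 44 * \<beta>) - 11 * \<beta> ^ 2 + 10 * \<beta> + 20 * m ^ 2
        + 20 * m * (\<alpha> + \<beta> + 1) + 3) * n ^ 2
     + 3 * (- 6 * \<alpha> ^ 3 + \<alpha> * (- 6 * \<beta> ^ 2 + 15 * \<beta> + 20 * m ^ 2 + 10 * (3 * \<beta> + 2) * m + 3)) * n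
     + 3 * (\<beta> * (5 * \<beta> + 10 * m ^ 2 + 10 * (\<beta> + 1) * m + 1)
        + 2 * \<alpha> ^ 2 * (- 6 * \<beta> + 10 * m + 5)) * n
     + (\<alpha> + \<beta>) * (3 * \<alpha> * (6 * \<alpha> + 6 * \<beta> + 1) - 4 * \<beta> - 1)
     - 9 * m ^ 4 - 18 * m ^ 3 * (\<alpha> + \<beta> + 1)
     + m ^ 2 * (27 * \<alpha> ^ 2 + 9 * \<alpha> * (2 * \<beta> - 3) - 9 * \<beta> * (\<beta> + 3) - 11)
     + m * (\<alpha> + \<beta> + 1) * (9 * \<alpha> * (4 * \<alpha> + 4 * \<beta> - 1) - 9 * \<beta> - 2)"

text \<open>
  The roots of \<open>rec_N2\<close> in \<open>n - 2\<close> are \<open>-3a, -2a-b, -a-2b, -3b\<close> for \<open>a = -m\<close> and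
  \<open>b = m + \<alpha> + \<beta> + 1\<close>, the parameters of the hypergeometric function. The source prints the
  last three factors with \<open>\<alpha> + \<beta>\<close> in place of \<open>\<alpha> + \<beta> + 1\<close>, that is, as
  \<open>(\<alpha> + \<beta> - m + n - 2)\<close>, \<open>(3\<alpha> + 3\<beta> + 3m + n - 2)\<close> and \<open>(2(\<alpha> + \<beta> - 1) + m + n)\<close>.
  That is a misprint: for \<open>m = \<alpha> = \<beta> = 1\<close> the cube is \<open>(1 - 2z)^3\<close>, whose \<open>z^3\<close> coefficient
  is \<open>-8\<close>, but the printed recurrence gives \<open>-279/40\<close>.
\<close>

definition rec_N2 :: "real \<Rightarrow> real \<Rightarrow> real \<Rightarrow> real \<Rightarrow> real" where
  "rec_N2 m \<alpha> \<beta> n =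
     (- 3 * m + n - 2) * ((\<alpha> + \<beta> + 1) - m + n - 2)
     * (3 * (\<alpha> + \<beta> + 1) + 3 * m + n - 2) * (2 * ((\<alpha> + \<beta> + 1) - 1) + m + n)"

end

theory Submission
  imports Defs
begin

text \<open>
  Two classical facts combine. First, the Jacobi polynomial is a multiple of
  \<open>F(-m, m + \<alpha> + \<beta> + 1; \<alpha> + 1; (1 - x) / 2)\<close>. The hypergeometric equation turns, under
  \<open>t = (1 - x) / 2\<close>, into an eigenvalue equation for the Jacobi differential operator, which is
  symmetric with respect to the weight \<open>(1 - x)\<^sup>\<alpha> (1 + x)\<^sup>\<beta>\<close> and triangular, with pairwise
  distinct eigenvalues, on the monomials. Hence an eigenpolynomial of degree \<open>m\<close> is orthogonal
  to everything of lower degree (\<open>jacobi_eigenpoly_orthogonal\<close>). Positivity of the weight makes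
  the polynomial with these properties unique (\<open>is_jacobi_poly_unique\<close>).

  Second, if \<open>f\<close> solves a linear equation of second order, then \<open>f\<^sup>3\<close> solves one of fourth order,
  its symmetric cube, because the four products \<open>f\<^sup>3, f\<^sup>2 f', f f'\<^sup>2, f'\<^sup>3\<close> span a space over
  the rational functions that is closed under differentiation. With \<open>\<theta> = z d/dz\<close> in place of
  \<open>d/dz\<close>, the symmetric cube of the hypergeometric equation has coefficients of degree three in \<open>z\<close> (\<open>fps_cube_ode\<close>), and
  reading off the coefficient of a power of \<open>z\<close> gives a recurrence that relates four consecutive
  coefficients of \<open>f\<^sup>3\<close>: the one in the theorem (\<open>hypergeo_cube_recurrence\<close>). Since \<open>D(n)\<close> does
  not vanish for \<open>\<alpha> > 0\<close>, the recurrence and the first three coefficients determine the others.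
  For \<open>f = F(-m, \<dots>)\<close> all series involved are polynomials, so convergence is immediate.
\<close>

section \<open>The symmetric cube of the hypergeometric equation\<close>

unbundle no vec_syntax
unbundle fps_syntax

text \<open>
  Write \<open>w\<^sub>i = f\<^bsup>3-i\<^esup> (\<theta> f)\<^sup>i\<close>. The equation for \<open>f\<close> expresses \<open>(1 - X) \<theta> w\<^sub>i\<close> through
  \<open>w\<^bsub>i-1\<^esub>\<close>, \<open>w\<^sub>i\<close> and \<open>w\<^bsub>i+1\<^esub>\<close>. Solving for \<open>w\<^sub>1\<close>, \<open>w\<^sub>2\<close>, \<open>w\<^sub>3\<close> in turn leaves one
  condition on \<open>w = w\<^sub>0\<close>. The auxiliary series are \<open>R2 = 6 (1 - X) w\<^sub>2\<close> and
  \<open>R3 = 6 (1 - X)\<^sup>2 w\<^sub>3\<close>; these powers of \<open>1 - X\<close> are the denominators that the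
  elimination produces, and clearing them keeps the coefficients polynomial.
\<close>

lemma fps_cube_ode:
  fixes f P Q :: "'a::comm_ring_1 fps"
  defines "w \<equiv> f ^ 3"
  assumes ode: "(1 - fps_X) * fps_XD (fps_XD f) + P * fps_XD f = Q * f"
  defines "R2 \<equiv> (1 - fps_X) * fps_XD (fps_XD w) + P * fps_XD w - 3 * Q * w"
  defines "R3 \<equiv> (1 - fps_X) * fps_XD R2 + (fps_X + 2 * P) * R2 - 4 * Q * (1 - fps_X) * fps_XD w"
  shows "(1 - fps_X) * fps_XD R3 + (2 * fps_X + 3 * P) * R3 = 3 * Q * (1 - fps_X) * R2"
proof -
  define g where "g = fps_XD f"
  define h where "h = fps_XD g"
  have mult: "fps_XD (u * v) = fps_XD u * v + u * fps_XD v" for u v :: "'a fps"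
    by (simp add: fps_XD_def algebra_simps)
  have XDX: "fps_XD (1 - fps_X) = - (fps_X :: 'a fps)" by (simp add: fps_XD_def)
  have h: "(1 - fps_X) * h = Q * f - P * g"
    using ode by (simp add: g_def h_def algebra_simps)
  have XDw: "fps_XD w = 3 * (f\<^sup>2 * g)"
    by (simp add: w_def power3_eq_cube power2_eq_square mult g_def algebra_simps)
  have c3: "fps_XD (numeral k * u) = numeral k * fps_XD u" for u :: "'a fps" and k
    by (simp add: fps_XD_def fps_numeral_fps_const algebra_simps)
  have c0: "fps_XD (numeral k) = (0 :: 'a fps)" for k
    by (simp add: fps_XD_def fps_numeral_fps_const)
  have XDDw: "fps_XD (fps_XD w) = 6 * (f * g\<^sup>2) + 3 * (f\<^sup>2 * h)"
    by (simp add: XDw c0 c3 mult power2_eq_square g_def[symmetric] h_def[symmetric] algebra_simps)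
  have "R2 = 6 * ((1 - fps_X) * (f * g\<^sup>2)) + 3 * f\<^sup>2 * ((1 - fps_X) * h) + P * fps_XD w - 3 * Q * w"
    unfolding R2_def XDDw by (simp add: algebra_simps)
  also have "\<dots> = 6 * ((1 - fps_X) * (f * g\<^sup>2))"
    unfolding h XDw unfolding w_def by (simp add: power3_eq_cube power2_eq_square algebra_simps)
  finally have R2: "R2 = 6 * ((1 - fps_X) * (f * g\<^sup>2))" .
  have XDR2: "fps_XD R2 = 6 * ((1 - fps_X) * (g ^ 3 + 2 * f * g * h) - fps_X * (f * g\<^sup>2))"
    unfolding R2 c3 mult XDX power2_eq_square
    by (simp add: mult c0 power3_eq_cube power2_eq_square g_def[symmetric] h_def[symmetric] algebra_simps)
  have XR2: "(1 - fps_X) * fps_XD R2 = 6 * ((1 - fps_X)\<^sup>2 * g ^ 3)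
          + 12 * (1 - fps_X) * f * g * ((1 - fps_X) * h) - fps_X * R2"
    unfolding XDR2 unfolding R2 by (simp add: power2_eq_square algebra_simps)
  have R3: "R3 = 6 * ((1 - fps_X)\<^sup>2 * g ^ 3)"
    unfolding R3_def XR2 h unfolding R2 XDw
    by (simp add: power2_eq_square power3_eq_cube algebra_simps)
  have XDR3: "fps_XD R3 = 6 * ((1 - fps_X)\<^sup>2 * (3 * g\<^sup>2 * h) - 2 * fps_X * (1 - fps_X) * g ^ 3)"
    unfolding R3 c3 mult XDX power2_eq_square power3_eq_cube
    by (simp add: c0 h_def[symmetric] algebra_simps)
  have XR3: "(1 - fps_X) * fps_XD R3 = 18 * (1 - fps_X)\<^sup>2 * g\<^sup>2 * ((1 - fps_X) * h) - 2 * fps_X * R3"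
    unfolding XDR3 unfolding R3 by (simp add: power2_eq_square algebra_simps)
  show ?thesis unfolding XR3 h unfolding R3 R2
    by (simp add: power2_eq_square power3_eq_cube algebra_simps)
qed


text \<open>
  The recurrence for the coefficients of \<open>f\<close> is the equation
  \<open>\<theta> (\<theta> + \<alpha>) f = X (\<theta> - m) (\<theta> + m + \<alpha> + \<beta> + 1) f\<close>, to which the preceding lemma applies.
  Since \<open>\<theta>\<close> multiplies the \<open>n\<close>-th coefficient by \<open>n\<close>, the coefficients of \<open>R2\<close> and \<open>R3\<close> are
  combinations of two and three consecutive coefficients of \<open>f\<^sup>3\<close>, and the final equation
  involves four.
\<close>

lemma hypergeo_cube_recurrence:
  fixes f :: "real fps" and m \<alpha> \<beta> :: real
  defines "A \<equiv> fps_nth (f ^ 3)"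
  assumes rec: "\<And>k. (real k + 1) * (\<alpha> + 1 + real k) * f $ Suc k
                    = (real k - m) * (m + \<alpha> + \<beta> + 1 + real k) * f $ k"
  shows "rec_D \<alpha> (real k + 2) * A (k + 3)
           = rec_N0 m \<alpha> \<beta> (real k + 2) * A (k + 2)
           + rec_N1 m \<alpha> \<beta> (real k + 2) * A (k + 1)
           + rec_N2 m \<alpha> \<beta> (real k + 2) * A k"
proof -
  define s t where "s = \<alpha> + \<beta> + 1" and "t = - m * (m + \<alpha> + \<beta> + 1)"
  define P Q :: "real fps" where "P = fps_const \<alpha> - fps_const s * fps_X"
    and "Q = fps_const t * fps_X"
  define R2 where "R2 = (1 - fps_X) * fps_XD (fps_XD (f ^ 3)) + P * fps_XD (f ^ 3) - 3 * Q * f ^ 3"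
  define R3 where "R3 = (1 - fps_X) * fps_XD R2 + (fps_X + 2 * P) * R2
                          - 4 * Q * (1 - fps_X) * fps_XD (f ^ 3)"
  have num: "(numeral n :: real fps) = fps_const (numeral n)" for n
    by (rule fps_numeral_fps_const)
  have ode: "(1 - fps_X) * fps_XD (fps_XD f) + P * fps_XD f = Q * f"
  proof (rule fps_ext)
    fix n show "((1 - fps_X) * fps_XD (fps_XD f) + P * fps_XD f) $ n = (Q * f) $ n"
    proof (cases n)
      case (Suc k)
      show ?thesis unfolding Suc
        by (simp add: P_def Q_def s_def t_def ring_distribs mult.assoc) (use rec[of k] in algebra)
    qed (simp add: P_def Q_def ring_distribs mult.assoc)
  qed
  \<comment> \<open>The multipliers \<open>r\<^sub>i\<close> and \<open>q\<^sub>i\<close> are those of \<open>R2\<close> and \<open>R3\<close>, as functions of the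
    index of the lowest coefficient.\<close>
  define r1 r0 where "r1 x = (x + 1 + \<alpha>) * (x + 1)" and "r0 x = (x + s) * x + 3 * t" for x
  define q2 q1 q0 where "q2 x = (x + 2 + 2 * \<alpha>) * r1 (x + 1)"
    and "q1 x = (x + 2 + 2 * \<alpha>) * r0 (x + 1) + (x + 2 * s) * r1 x + 4 * t * (x + 1)"
    and "q0 x = (x + 2 * s) * r0 x + 4 * t * x" for x
  have R2: "R2 $ Suc n = r1 (real n) * A (Suc n) - r0 (real n) * A n" for n
    by (simp add: R2_def A_def r1_def r0_def P_def Q_def num ring_distribs mult.assoc)
  have "R3 $ Suc (Suc n) = (real n + 2 + 2 * \<alpha>) * R2 $ Suc (Suc n)
        - (real n + 2 * s) * R2 $ Suc n
        - 4 * t * ((real n + 1) * A (Suc n) - real n * A n)" for n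
    by (simp add: R3_def A_def P_def Q_def num ring_distribs mult.assoc)
  then have R3: "R3 $ Suc (Suc n) = q2 (real n) * A (Suc (Suc n)) - q1 (real n) * A (Suc n)
                   + q0 (real n) * A n" for n
    unfolding R2 q2_def q1_def q0_def by (simp add: algebra_simps)
  have "((1 - fps_X) * fps_XD R3 + (2 * fps_X + 3 * P) * R3) $ Suc (Suc (Suc k))
      = (3 * Q * (1 - fps_X) * R2) $ Suc (Suc (Suc k))"
    unfolding R3_def R2_def by (subst fps_cube_ode[OF ode]) simp
  then have "(real k + 3 + 3 * \<alpha>) * R3 $ Suc (Suc (Suc k))
      = (real k + 3 * s) * R3 $ Suc (Suc k) + 3 * t * (R2 $ Suc (Suc k) - R2 $ Suc k)"
    by (simp add: P_def Q_def num ring_distribs mult.assoc)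
  then have nested: "(x + 3 + 3 * \<alpha>) * (q2 (x + 1) * A (k + 3) - q1 (x + 1) * A (k + 2) + q0 (x + 1) * A (k + 1))
      = (x + 3 * s) * (q2 x * A (k + 2) - q1 x * A (k + 1) + q0 x * A k)
        + 3 * t * (r1 (x + 1) * A (k + 2) - r0 (x + 1) * A (k + 1) - (r1 x * A (k + 1) - r0 x * A k))"
    if "x = real k" for x
    unfolding R2 R3 that by (simp add: eval_nat_numeral add.commute)
  \<comment> \<open>Eliminating \<open>R2\<close> and \<open>R3\<close> yields the expanded polynomials of the recurrence at
    \<open>n = x + 2\<close>, where \<open>x\<close> is the index of the lowest of the four coefficients.\<close>
  have rec_eqs:
    "rec_D \<alpha> (x + 2) = (x + 3 + 3 * \<alpha>) * q2 (x + 1)"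
    "rec_N0 m \<alpha> \<beta> (x + 2)
       = (x + 3 + 3 * \<alpha>) * q1 (x + 1) + (x + 3 * s) * q2 x + 3 * t * r1 (x + 1)"
    "rec_N1 m \<alpha> \<beta> (x + 2)
       = - ((x + 3 + 3 * \<alpha>) * q0 (x + 1) + (x + 3 * s) * q1 x + 3 * t * (r0 (x + 1) + r1 x))"
    "rec_N2 m \<alpha> \<beta> (x + 2) = (x + 3 * s) * q0 x + 3 * t * r0 x" for x
    unfolding rec_D_def rec_N0_def rec_N1_def rec_N2_def
      q2_def q1_def q0_def r1_def r0_def s_def t_def
    by algebra+
  show ?thesis
    unfolding rec_eqs using nested[OF refl] by (simp add: algebra_simps)
qed


section \<open>Orthogonality and uniqueness of Jacobi polynomials\<close>

definition jacobi_weight :: "real \<Rightarrow> real \<Rightarrow> real \<Rightarrow> real" where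
  "jacobi_weight \<alpha> \<beta> x = (1 - x) powr \<alpha> * (1 + x) powr \<beta>"

definition jacobi_op :: "real \<Rightarrow> real \<Rightarrow> real poly \<Rightarrow> real poly" where
  "jacobi_op \<alpha> \<beta> p =
     [:1, 0, -1:] * pderiv (pderiv p) + [:\<beta> - \<alpha>, - (\<alpha> + \<beta> + 2):] * pderiv p"

text \<open>
  The operator is triangular on the monomials: it does not raise the degree, and \<open>x\<^sup>n\<close> is mapped to
  \<open>- n (n + \<alpha> + \<beta> + 1) x\<^sup>n\<close> plus lower terms.
\<close>

lemma coeff_jacobi_op:
  "coeff (jacobi_op \<alpha> \<beta> p) n =
     (real n + 2) * (real n + 1) * coeff p (n + 2) + (\<beta> - \<alpha>) * (real n + 1) * coeff p (n + 1)
     - real n * (real n + \<alpha> + \<beta> + 1) * coeff p n"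
  unfolding jacobi_op_def
  by (cases n; cases "n - 1") (auto simp: coeff_pderiv coeff_pCons algebra_simps split: nat.split)

lemma jacobi_weight_mult_poly:
  assumes "\<alpha> > 0" "\<beta> > 0"
  shows "continuous_on {-1..1} (\<lambda>x. jacobi_weight \<alpha> \<beta> x * poly p x)"
    and "(\<lambda>x. jacobi_weight \<alpha> \<beta> x * poly p x) integrable_on {-1..1}"
proof -
  show "continuous_on {-1..1} (\<lambda>x. jacobi_weight \<alpha> \<beta> x * poly p x)"
    unfolding jacobi_weight_def using assms by (intro continuous_intros continuous_on_powr') auto
  then show "(\<lambda>x. jacobi_weight \<alpha> \<beta> x * poly p x) integrable_on {-1..1}"
    by (rule integrable_continuous_real)
qed

text \<open>
  In Sturm-Liouville form the operator is \<open>W L p = ((1 - x\<^sup>2) W p')'\<close> with \<open>W\<close> the weight, so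
  \<open>W (q L p - p L q)\<close> is the derivative of \<open>(1 - x\<^sup>2) W (p' q - p q')\<close>, which vanishes at both
  endpoints.
\<close>

lemma jacobi_op_self_adjoint:
  assumes "\<alpha> > 0" "\<beta> > 0"
  shows "((\<lambda>x. jacobi_weight \<alpha> \<beta> x * poly (jacobi_op \<alpha> \<beta> p * q - p * jacobi_op \<alpha> \<beta> q) x)
           has_integral 0) {-1..1}"
proof -
  define r where "r = pderiv p * q - p * pderiv q"
  define \<Phi> where "\<Phi> x = (1 - x) powr (\<alpha> + 1) * (1 + x) powr (\<beta> + 1) * poly r x" for x :: real
  have "((\<lambda>x. jacobi_weight \<alpha> \<beta> x * poly (jacobi_op \<alpha> \<beta> p * q - p * jacobi_op \<alpha> \<beta> q) x)
           has_integral (\<Phi> 1 - \<Phi> (-1))) {-1..1}"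
  proof (rule fundamental_theorem_of_calculus_interior)
    show "continuous_on {-1..1} \<Phi>"
      unfolding \<Phi>_def using assms by (intro continuous_intros continuous_on_powr') auto
    fix x :: real assume "x \<in> {-1<..<1}"
    then have x: "1 - x > 0" "1 + x > 0" by auto
    have "(\<Phi> has_real_derivative
        - ((\<alpha> + 1) * (1 - x) powr \<alpha>) * (1 + x) powr (\<beta> + 1) * poly r x
        + (1 - x) powr (\<alpha> + 1) * ((\<beta> + 1) * (1 + x) powr \<beta>) * poly r x
        + (1 - x) powr (\<alpha> + 1) * (1 + x) powr (\<beta> + 1) * poly (pderiv r) x) (at x)"
      unfolding \<Phi>_def using x
      by (auto intro!: derivative_eq_intros simp: algebra_simps)
    also have "(1 - x) powr (\<alpha> + 1) = (1 - x) powr \<alpha> * (1 - x)" using x by (simp add: powr_add)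
    also have "(1 + x) powr (\<beta> + 1) = (1 + x) powr \<beta> * (1 + x)" using x by (simp add: powr_add)
    finally show "(\<Phi> has_vector_derivative jacobi_weight \<alpha> \<beta> x *
        poly (jacobi_op \<alpha> \<beta> p * q - p * jacobi_op \<alpha> \<beta> q) x) (at x)"
      unfolding has_real_derivative_iff_has_vector_derivative[symmetric]
      by (rule DERIV_cong)
         (simp add: jacobi_weight_def jacobi_op_def r_def pderiv_diff pderiv_mult algebra_simps)
  qed simp
  also have "\<Phi> 1 - \<Phi> (-1) = 0" by (simp add: \<Phi>_def)
  finally show ?thesis .
qed

text \<open>
  For \<open>q\<close> of degree \<open>d\<close>, triangularity gives \<open>L q = - ev d q + r\<close> with \<open>r\<close> of smaller degree.
  By induction \<open>p\<close> is orthogonal to \<open>r\<close>, so symmetry of \<open>L\<close> reduces to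
  \<open>(ev d - ev m) \<langle>p, q\<rangle> = 0\<close>, and \<open>ev d < ev m\<close> for \<open>d < m\<close>.
\<close>

lemma jacobi_eigenpoly_orthogonal:
  assumes pos: "\<alpha> > 0" "\<beta> > 0"
    and eigen: "jacobi_op \<alpha> \<beta> p = smult (- (real m * (real m + \<alpha> + \<beta> + 1))) p"
    and "degree q < m"
  shows "((\<lambda>x. jacobi_weight \<alpha> \<beta> x * poly (p * q) x) has_integral 0) {-1..1}"
  using \<open>degree q < m\<close>
proof (induction "degree q" arbitrary: q rule: less_induct)
  case less
  define d where "d = degree q"
  define ev where "ev n = real n * (real n + \<alpha> + \<beta> + 1)" for n
  define r where "r = jacobi_op \<alpha> \<beta> q + smult (ev d) q"
  have "coeff q i = 0" if "i > d" for i using that by (simp add: d_def coeff_eq_0)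
  then have "coeff r i = 0" if "i \<ge> d" for i
    using that by (cases "i = d") (auto simp: r_def coeff_jacobi_op ev_def)
  then have "r = 0 \<or> degree r < d"
    by (metis eq_zero_or_degree_less degree_le less_or_eq_imp_le)
  then have r0: "((\<lambda>x. jacobi_weight \<alpha> \<beta> x * poly (p * r) x) has_integral 0) {-1..1}"
    using less d_def by auto
  obtain I where I: "((\<lambda>x. jacobi_weight \<alpha> \<beta> x * poly (p * q) x) has_integral I) {-1..1}"
    using jacobi_weight_mult_poly(2)[OF pos] unfolding integrable_on_def by blast
  have "((\<lambda>x. jacobi_weight \<alpha> \<beta> x * poly (jacobi_op \<alpha> \<beta> p * q - p * jacobi_op \<alpha> \<beta> q) x)
          has_integral (ev d - ev m) * I - 0) {-1..1}"
    using has_integral_diff[OF has_integral_mult_right[OF I, of "ev d - ev m"] r0]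
    by (rule has_integral_eq[rotated]) (simp add: r_def eigen ev_def algebra_simps)
  from has_integral_unique[OF this jacobi_op_self_adjoint[OF pos]]
  have "(ev d - ev m) * I = 0" by simp
  moreover have "ev d < ev m"
    unfolding ev_def using less.prems pos by (intro mult_strict_mono) (auto simp: d_def)
  ultimately show ?case using I by simp
qed

lemma is_jacobi_poly_alt:
  "is_jacobi_poly m \<alpha> \<beta> p \<longleftrightarrow> degree p = m \<and>
     (\<forall>q. degree q < m \<longrightarrow>
        ((\<lambda>x. jacobi_weight \<alpha> \<beta> x * poly (p * q) x) has_integral 0) {-1..1}) \<and>
     poly p 1 = pochhammer (\<alpha> + 1) m / fact m"
  by (simp add: is_jacobi_poly_def jacobi_weight_def mult.assoc)

text \<open>
  The combination \<open>r\<close> of two candidates in which the leading terms cancel has degree below \<open>m\<close>.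
  Each candidate is orthogonal to \<open>r\<close>, hence \<open>r\<close> is orthogonal to itself and vanishes. The
  candidates are therefore proportional, and the common nonzero value at \<open>1\<close> makes them equal.
\<close>

lemma is_jacobi_poly_unique:
  assumes pos: "\<alpha> > 0" "\<beta> > 0"
    and p: "is_jacobi_poly m \<alpha> \<beta> p" and q: "is_jacobi_poly m \<alpha> \<beta> q"
  shows "p = q"
proof -
  define r where "r = smult (lead_coeff q) p - smult (lead_coeff p) q"
  have deg: "degree p = m" "degree q = m" using p q by (auto simp: is_jacobi_poly_def)
  have "r = 0"
  proof (rule ccontr)
    assume "r \<noteq> 0"
    have "degree r \<le> m" unfolding r_def using deg by (intro degree_diff_le) auto
    moreover have "coeff r m = 0" by (simp add: r_def deg)
    ultimately have "degree r < m"
      using \<open>r \<noteq> 0\<close> eq_zero_or_degree_less by blast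
    with p q have
      "((\<lambda>x. jacobi_weight \<alpha> \<beta> x * poly (p * r) x) has_integral 0) {-1..1}"
      "((\<lambda>x. jacobi_weight \<alpha> \<beta> x * poly (q * r) x) has_integral 0) {-1..1}"
      by (auto simp: is_jacobi_poly_alt)
    from has_integral_diff[OF this[THEN has_integral_mult_right], of "lead_coeff q" "lead_coeff p"]
    have int: "((\<lambda>x. jacobi_weight \<alpha> \<beta> x * poly (r * r) x) has_integral 0) (cbox (-1) 1)"
      by (simp add: r_def algebra_simps)
    have r0: "poly r x = 0" if "x \<in> {-1<..<1}" for x
    proof -
      have "jacobi_weight \<alpha> \<beta> x * poly (r * r) x = 0"
      proof (rule has_integral_0_cbox_imp_0[OF _ _ int])
        show "continuous_on (cbox (-1) 1) (\<lambda>x. jacobi_weight \<alpha> \<beta> x * poly (r * r) x)"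
          unfolding cbox_interval by (rule jacobi_weight_mult_poly(1)[OF pos])
      qed (use that in \<open>auto simp: jacobi_weight_def\<close>)
      then show ?thesis using that by (auto simp: jacobi_weight_def)
    qed
    have "infinite {-1<..<1::real}" by simp
    moreover have "{-1<..<1} \<subseteq> {x. poly r x = 0}" using r0 by blast
    ultimately show False using poly_roots_finite[OF \<open>r \<noteq> 0\<close>] finite_subset by blast
  qed
  have val: "poly p 1 = poly q 1" "poly q 1 > 0"
    using p q pos by (auto simp: is_jacobi_poly_def intro!: divide_pos_pos pochhammer_pos)
  have "lead_coeff q * poly p 1 = lead_coeff p * poly q 1"
    using arg_cong[OF \<open>r = 0\<close>, of "\<lambda>r. poly r 1"] by (simp add: r_def)
  with val have "lead_coeff p = lead_coeff q" by simp
  moreover have "lead_coeff q \<noteq> 0" using val by auto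
  ultimately show ?thesis using \<open>r = 0\<close>
    by (metis r_def eq_iff_diff_eq_0 smult_cancel)
qed

section \<open>Jacobi polynomials as hypergeometric polynomials\<close>

definition hypergeo_poly :: "nat \<Rightarrow> real \<Rightarrow> real \<Rightarrow> real poly" where
  "hypergeo_poly m b c =
     (\<Sum>k\<le>m. monom (pochhammer (- real m) k * pochhammer b k / (pochhammer c k * fact k)) k)"

text \<open>
  The truncation at \<open>m\<close> in the definition loses nothing, since \<open>(-m)\<^sub>k\<close> vanishes for \<open>k > m\<close>; the
  coefficients satisfy the hypergeometric recurrence for every index.
\<close>

lemma coeff_hypergeo_poly:
  "coeff (hypergeo_poly m b c) k =
     pochhammer (- real m) k * pochhammer b k / (pochhammer c k * fact k)"
proof (cases "k \<le> m")
  case False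
  then have "pochhammer (- real m) k = 0" by (simp add: pochhammer_of_nat_eq_0_iff)
  then show ?thesis using False by (simp add: hypergeo_poly_def coeff_sum coeff_monom)
qed (simp add: hypergeo_poly_def coeff_sum coeff_monom)

lemma coeff_hypergeo_poly_Suc:
  assumes "c > 0"
  shows "(real k + 1) * (c + real k) * coeff (hypergeo_poly m b c) (Suc k)
           = (real k - real m) * (b + real k) * coeff (hypergeo_poly m b c) k"
proof -
  have "c + real k > 0" "pochhammer c k > 0" using assms by (auto intro: pochhammer_pos)
  then show ?thesis
    unfolding coeff_hypergeo_poly pochhammer_Suc fact_Suc by (simp add: divide_simps)
qed

lemma hypergeo_poly_ode:
  assumes "c > 0"
  shows "[:0, 1, -1:] * pderiv (pderiv (hypergeo_poly m b c))
           + [:c, - (b - real m + 1):] * pderiv (hypergeo_poly m b c)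
         = smult (- real m * b) (hypergeo_poly m b c)"
proof (rule poly_eqI)
  fix n
  show "coeff ([:0, 1, -1:] * pderiv (pderiv (hypergeo_poly m b c))
           + [:c, - (b - real m + 1):] * pderiv (hypergeo_poly m b c)) n
         = coeff (smult (- real m * b) (hypergeo_poly m b c)) n"
    using coeff_hypergeo_poly_Suc[OF assms, of n m b]
    by (cases n; cases "n - 1")
       (auto simp: coeff_pderiv coeff_pCons algebra_simps split: nat.split)
qed

text \<open>
  With \<open>t = (1 - x) / 2\<close> one has \<open>1 - x\<^sup>2 = 4 t (1 - t)\<close> and \<open>d/dx = - d/dt / 2\<close>, which turns the
  hypergeometric operator with \<open>c = \<alpha> + 1\<close> and \<open>a + b + 1 = \<alpha> + \<beta> + 2\<close> into the Jacobi
  operator. The point \<open>x = 1\<close> corresponds to \<open>t = 0\<close>, where the hypergeometric polynomial is \<open>1\<close>.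
\<close>

lemma jacobi_poly_eq_hypergeo:
  assumes pos: "\<alpha> > 0" "\<beta> > 0"
  shows "jacobi_poly m \<alpha> \<beta> = smult (pochhammer (\<alpha> + 1) m / fact m)
           (pcompose (hypergeo_poly m (real m + \<alpha> + \<beta> + 1) (\<alpha> + 1)) [:1/2, -1/2:])"
proof -
  define b c where "b = real m + \<alpha> + \<beta> + 1" and "c = \<alpha> + 1"
  define h where "h = hypergeo_poly m b c"
  define K where "K = pochhammer c m / fact m"
  define p where "p = smult K (pcompose h [:1/2, -1/2:])"
  have "b > 0" "c > 0" using pos by (auto simp: b_def c_def)
  have "K > 0" using \<open>c > 0\<close> by (simp add: K_def pochhammer_pos)
  have "coeff h m \<noteq> 0"
    using \<open>b > 0\<close> \<open>c > 0\<close>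
    by (auto simp: h_def coeff_hypergeo_poly pochhammer_of_nat_eq_0_iff dest: pochhammer_pos[of _ m])
  moreover have "degree h \<le> m"
    unfolding h_def hypergeo_poly_def by (intro degree_sum_le) (auto intro: order.trans[OF degree_monom_le])
  ultimately have "degree h = m" by (simp add: le_antisym le_degree)
  then have deg: "degree p = m" using \<open>K > 0\<close> by (simp add: p_def degree_pcompose)
  have "jacobi_op \<alpha> \<beta> p = smult (- (real m * (real m + \<alpha> + \<beta> + 1))) p"
  proof (rule poly_eq_poly_eq_iff[THEN iffD1], rule ext)
    have "pderiv [:1/2, -1/2 :: real:] = [:-1/2:]" by (simp add: pderiv_pCons)
    then have dp: "pderiv p = smult (- K / 2) (pcompose (pderiv h) [:1/2, -1/2:])"
      and ddp: "pderiv (pderiv p) = smult (K / 4) (pcompose (pderiv (pderiv h)) [:1/2, -1/2:])"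
      by (simp_all add: p_def pderiv_smult pderiv_minus pderiv_pcompose)
    fix x :: real
    define t where "t = (1 - x) / 2"
    have x: "x = 1 - 2 * t" by (simp add: t_def field_simps)
    have arg: "1 / 2 - x / 2 = t" by (simp add: t_def field_simps)
    have "poly (jacobi_op \<alpha> \<beta> p) x
            = K * (t * (1 - t) * poly (pderiv (pderiv h)) t
                   + (c - (b - real m + 1) * t) * poly (pderiv h) t)"
      unfolding jacobi_op_def ddp unfolding dp
      by (simp add: poly_pcompose arg) (simp add: x b_def c_def field_simps)
    also have "t * (1 - t) * poly (pderiv (pderiv h)) t
                 + (c - (b - real m + 1) * t) * poly (pderiv h) t = - real m * b * poly h t"
      using arg_cong[OF hypergeo_poly_ode[OF \<open>c > 0\<close>, of m b], of "\<lambda>p. poly p t"]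
      by (simp add: h_def algebra_simps)
    finally show "poly (jacobi_op \<alpha> \<beta> p) x = poly (smult (- (real m * (real m + \<alpha> + \<beta> + 1))) p) x"
      by (simp add: p_def poly_pcompose arg b_def)
  qed
  from jacobi_eigenpoly_orthogonal[OF pos this] have
    "is_jacobi_poly m \<alpha> \<beta> p"
    using deg by (auto simp: is_jacobi_poly_alt p_def K_def c_def poly_pcompose h_def poly_0_coeff_0 coeff_hypergeo_poly)
  then show ?thesis unfolding jacobi_poly_def
    using is_jacobi_poly_unique[OF pos] by (auto simp: p_def h_def K_def b_def c_def)
qed

section \<open>The cube of a Jacobi polynomial\<close>

lemma map_poly_of_real_mult:
  "map_poly complex_of_real (p * q) = map_poly complex_of_real p * map_poly complex_of_real q"
  by (rule poly_eqI) (simp add: coeff_map_poly coeff_mult)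

lemma poly_map_of_real_pcompose:
  "poly (map_poly complex_of_real (pcompose p q)) z
     = poly (map_poly complex_of_real p) (poly (map_poly complex_of_real q) z)"
proof (induction p)
  case (pCons a p)
  have "map_poly complex_of_real ([:a:] + r) = [:complex_of_real a:] + map_poly complex_of_real r" for r
    by (rule poly_eqI) (simp add: coeff_map_poly coeff_pCons split: nat.split)
  then show ?case
    using pCons by (simp add: pcompose_pCons map_poly_pCons map_poly_of_real_mult)
qed simp

lemma hyp2F1_eq_hypergeo_poly:
  "hyp2F1 (- of_nat m) (complex_of_real b) (complex_of_real c) z
     = poly (map_poly complex_of_real (hypergeo_poly m b c)) z"
proof -
  have m: "- of_nat m = complex_of_real (- real m)" by simp
  have "fps_hypergeo [- of_nat m, complex_of_real b] [complex_of_real c] 1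
          = fps_of_poly (map_poly complex_of_real (hypergeo_poly m b c))"
    by (rule fps_ext) (simp add: coeff_map_poly coeff_hypergeo_poly m pochhammer_of_real del: of_real_minus)
  then show ?thesis by (simp add: hyp2F1_def)
qed

lemma fps_cube_nth:
  fixes f :: "real fps"
  assumes "f $ 0 = 1"
  shows "(f ^ 3) $ 0 = 1" "(f ^ 3) $ 1 = 3 * f $ 1" "(f ^ 3) $ 2 = 3 * f $ 2 + 3 * (f $ 1)\<^sup>2"
  using assms
  by (simp_all add: power3_eq_cube power2_eq_square fps_mult_nth numeral_2_eq_2)

lemma hypergeo_cube_recurrence_unique:
  fixes v :: "nat \<Rightarrow> real"
  assumes pos: "\<alpha> > 0"
    and v0: "v 0 = 1"
    and v1: "v 1 = - 3 * real m * (real m + \<alpha> + \<beta> + 1) / (\<alpha> + 1)"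
    and v2: "v 2 = 3 * real m ^ 2 * (\<alpha> + \<beta> + real m + 1) ^ 2 / (\<alpha> + 1) ^ 2
             + 3 * (real m - 1) * real m * (\<alpha> + \<beta> + real m + 2) * (\<alpha> + \<beta> + real m + 1)
               / (2 * (\<alpha> + 1) * (\<alpha> + 2))"
    and rec: "\<And>n. n \<ge> 2 \<Longrightarrow>
           v (n + 1) = rec_N0 (real m) \<alpha> \<beta> (real n) / rec_D \<alpha> (real n) * v n
                     + rec_N1 (real m) \<alpha> \<beta> (real n) / rec_D \<alpha> (real n) * v (n - 1)
                     + rec_N2 (real m) \<alpha> \<beta> (real n) / rec_D \<alpha> (real n) * v (n - 2)"
  shows "v n = coeff (hypergeo_poly m (real m + \<alpha> + \<beta> + 1) (\<alpha> + 1) ^ 3) n"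
proof -
  define b where "b = real m + \<alpha> + \<beta> + 1"
  define f where "f = fps_of_poly (hypergeo_poly m b (\<alpha> + 1))"
  have f: "f $ k = pochhammer (- real m) k * pochhammer b k / (pochhammer (\<alpha> + 1) k * fact k)" for k
    by (simp add: f_def coeff_hypergeo_poly)
  have cube: "rec_D \<alpha> (real k + 2) * (f ^ 3) $ (k + 3)
           = rec_N0 (real m) \<alpha> \<beta> (real k + 2) * (f ^ 3) $ (k + 2)
           + rec_N1 (real m) \<alpha> \<beta> (real k + 2) * (f ^ 3) $ (k + 1)
           + rec_N2 (real m) \<alpha> \<beta> (real k + 2) * (f ^ 3) $ k" for k
    using coeff_hypergeo_poly_Suc[of "\<alpha> + 1"] pos
    by (intro hypergeo_cube_recurrence) (simp add: f_def b_def)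
  have D: "rec_D \<alpha> (real k + 2) > 0" for k
    using pos by (auto simp: rec_D_def intro!: mult_pos_pos add_pos_pos)
  have f0: "f $ 0 = 1" by (simp add: f)
  have f1: "f $ 1 = - real m * b / (\<alpha> + 1)" by (simp add: f)
  have f2: "f $ 2 = (real m - 1) * real m * (b + 1) * b / (2 * (\<alpha> + 1) * (\<alpha> + 2))"
    by (simp add: f numeral_2_eq_2 pochhammer_Suc algebra_simps)
  have start: "v 1 = 3 * f $ 1" "v 2 = 3 * f $ 2 + 3 * (f $ 1)\<^sup>2"
    unfolding f1 f2 v1 v2 by (simp_all add: b_def power_divide power_mult_distrib ac_simps)
  have "v n = (f ^ 3) $ n"
  proof (induction n rule: less_induct)
    case (less n)
    have "n = 0 \<or> n = 1 \<or> n = 2 \<or> n = (n - 3) + 3" by arith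
    then consider "n = 0" | "n = 1" | "n = 2" | k where "n = k + 3" by blast
    then show ?case
    proof cases
      case 4
      have "rec_D \<alpha> (real k + 2) * v (k + 3) = rec_N0 (real m) \<alpha> \<beta> (real k + 2) * v (k + 2)
           + rec_N1 (real m) \<alpha> \<beta> (real k + 2) * v (k + 1)
           + rec_N2 (real m) \<alpha> \<beta> (real k + 2) * v k"
      proof -
        have k: "real (k + 2) = real k + 2" "k + 2 + 1 = k + 3" "k + 2 - 1 = k + 1" "k + 2 - 2 = k"
          by simp_all
        show ?thesis
          using D[of k] unfolding rec[of "k + 2", unfolded k, OF le_add2] by (simp add: field_simps)
      qed
      also have "\<dots> = rec_D \<alpha> (real k + 2) * (f ^ 3) $ (k + 3)"
        unfolding cube using 4 less by simp
      finally show ?thesis using D[of k] 4 by simp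
    qed (simp_all add: fps_cube_nth f0 start v0 del: One_nat_def)
  qed
  then show ?thesis by (simp add: f_def b_def flip: fps_of_poly_power)
qed

theorem corollary3p6:
  fixes m :: nat and \<alpha> \<beta> :: real and z :: complex and v :: "nat \<Rightarrow> real"
  assumes "\<alpha> > 0" and "\<beta> > 0" and "norm z < 1"
    and "v 0 = 1"
    and "v 1 = - 3 * real m * (real m + \<alpha> + \<beta> + 1) / (\<alpha> + 1)"
    and "v 2 = 3 * real m ^ 2 * (\<alpha> + \<beta> + real m + 1) ^ 2 / (\<alpha> + 1) ^ 2
             + 3 * (real m - 1) * real m * (\<alpha> + \<beta> + real m + 2) * (\<alpha> + \<beta> + real m + 1)
               / (2 * (\<alpha> + 1) * (\<alpha> + 2))"
    and "\<And>n. n \<ge> 2 \<Longrightarrow>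
           v (n + 1) = rec_N0 (real m) \<alpha> \<beta> (real n) / rec_D \<alpha> (real n) * v n
                     + rec_N1 (real m) \<alpha> \<beta> (real n) / rec_D \<alpha> (real n) * v (n - 1)
                     + rec_N2 (real m) \<alpha> \<beta> (real n) / rec_D \<alpha> (real n) * v (n - 2)"
  shows "jacobi_P m \<alpha> \<beta> (1 - 2 * z) ^ 3
           = complex_of_real (pochhammer (\<alpha> + 1) m / fact m) ^ 3
             * hyp2F1 (- of_nat m) (complex_of_real (real m + \<alpha> + \<beta> + 1))
                 (complex_of_real (\<alpha> + 1)) z ^ 3
       \<and> summable (\<lambda>n. complex_of_real (v n) * z ^ n)
       \<and> jacobi_P m \<alpha> \<beta> (1 - 2 * z) ^ 3
           = complex_of_real (pochhammer (\<alpha> + 1) m / fact m) ^ 3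
             * (\<Sum>n. complex_of_real (v n) * z ^ n)"
proof -
  define b c h K where "b = real m + \<alpha> + \<beta> + 1" and "c = \<alpha> + 1"
    and "h = hypergeo_poly m b c" and "K = pochhammer (\<alpha> + 1) m / fact m"
  define H where "H = map_poly complex_of_real h"
  have hyp: "hyp2F1 (- of_nat m) (complex_of_real b) (complex_of_real c) z = poly H z"
    unfolding H_def h_def by (rule hyp2F1_eq_hypergeo_poly)
  have "jacobi_P m \<alpha> \<beta> (1 - 2 * z) = complex_of_real K * poly H (poly [:1/2, -1/2:] (1 - 2 * z))"
    using assms(1,2)
    by (simp add: jacobi_P_def jacobi_poly_eq_hypergeo map_poly_smult poly_map_of_real_pcompose
        map_poly_pCons H_def h_def b_def c_def K_def)
  also have "poly [:1/2, -1/2:] (1 - 2 * z) = z" by (simp add: field_simps)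
  finally have jac: "jacobi_P m \<alpha> \<beta> (1 - 2 * z) ^ 3 = complex_of_real K ^ 3 * poly H z ^ 3"
    by (simp add: power_mult_distrib)
  have v: "v n = coeff (h ^ 3) n" for n
    unfolding h_def b_def c_def by (rule hypergeo_cube_recurrence_unique[OF assms(1,4-7)])
  have "coeff (H ^ 3) n = complex_of_real (v n)" for n
    by (simp add: v H_def power3_eq_cube coeff_map_poly h_def b_def c_def flip: map_poly_of_real_mult)
  then have "(\<lambda>n. complex_of_real (v n) * z ^ n) sums (poly H z ^ 3)"
    using sums_eval_fps[of z "fps_of_poly (H ^ 3)"] by (simp add: poly_power)
  then have "summable (\<lambda>n. complex_of_real (v n) * z ^ n)"
    "(\<Sum>n. complex_of_real (v n) * z ^ n) = poly H z ^ 3"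
    by (auto simp: sums_iff)
  then show ?thesis using jac hyp by (simp add: b_def c_def K_def)
qed

end
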